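(* Let $p\ge2$ and $\mathcal{B}\subset\Sigma_{2\times 2}(p)$. Suppose there exists $k\geq 2$ such that (i) $r(\mathbb{H}_{k})=c(\mathbb{H}_{k})$ and $r(\mathbb{V}_{k})=c(\mathbb{V}_{k})$; (ii) $\mathcal{B}$ satisfies the $k$ hole-filling condition $(\mathrm{HFC})_{k}$ with size $(M,N)$ for some $M,N\geq 2k-3$; and (iii) for these $M,N$, $\mathbb{H}_{k}$ is weakly $(M-2k+5)$-primitive and $\mathbb{V}_{k}$ is weakly $(N-2k+5)$-primitive. Then $\Sigma(\mathcal{B})$ has strong specification.
   Context: Lattices and patterns. $\mathcal{S}_p=\{0,1,\dots,p-1\}$ is the set of $p$ colors. For $m,n\ge1$ and $(i,j)\in\mathbb{Z}^2$, $\mathbb{Z}_{m\times n}((i,j))=\{(i+n_1,j+n_2): 0\le n_1\le m-1,\ 0\le n_2\le n-1\}$ and $\mathbb{Z}_{m\times n}=\mathbb{Z}_{m\times n}((0,0))$. $\Sigma_{m\times n}(p)=\mathcal{S}_p^{\mathbb{Z}_{m\times n}}$. Given $\mathcal{B}\subset\Sigma_{2\times2}(p)$ and $R\subset\mathbb{Z}^2$, a pattern $U\in\mathcal{S}_p^R$ is $\mathcal{B}$-admissible if $U|_{\mathbb{Z}_{2\times2}((i,j))}\in\mathcal{B}$ (after translation) whenever $\mathbb{Z}_{2\times2}((i,j))\subset R$; $\Sigma_R(\mathcal{B})$ is the set of these, and $\Sigma(\mathcal{B})=\Sigma_{\mathbb{Z}^2}(\mathcal{B})$. Counting function: $\psi(u_1,\dots,u_n)=1+\sum_{k=1}^n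 u_kp^{n-k}$ for $u_k\in\mathcal{S}_p$. Transition matrices. For $n\ge2$, $\mathbb{H}_n=\mathbb{H}_n(\mathcal{B})$ is the $p^n\times p^n$ zero-one matrix whose $(i,j)$ entry is $1$ iff the pattern $(u_{s,t})_{0\le s\le1,\,0\le t\le n-1}$ on $\mathbb{Z}_{2\times n}$ with $i=\psi(u_{0,0},\dots,u_{0,n-1})$ and $j=\psi(u_{1,0},\dots,u_{1,n-1})$ is $\mathcal{B}$-admissible. $\mathbb{V}_n=\mathbb{V}_n(\mathcal{B})$ is the $p^n\times p^n$ zero-one matrix whose $(i,j)$ entry is $1$ iff the pattern $(u_{s,t})_{0\le s\le n-1,\,0\le t\le1}$ on $\mathbb{Z}_{n\times2}$ with $i=\psi(u_{0,0},\dots,u_{n-1,0})$ and $j=\psi(u_{0,1},\dots,u_{n-1,1})$ is $\mathcal{B}$-admissible. For a non-negative square matrix $A$, $r(A)$ is the set of indices of nonzero rows of $A$ and $c(A)$ the set of indices of nonzero columns of $A$. $A$ is weakly $N$-primitive ($N\ge1$) if for all $n\ge N$ and all $i\in r(A)$, $j\in c(A)$, $(A^n)_{i,j}>0$. Hole-filling condition. For $M,N\ge1$, $d\ge 1$, the annular lattice is $\mathcal{A}_{M\times N;d}((i,j))=\mathbb{Z}_{(M+2d)\times(N+2d)}((i-d,j-d))\setminus\mathbb{Z}_{M\times N}((i,j))$, and $\mathcal{A}_{M\times N}=\mathcal{A}_{M\times N;2}((0,0))$. For $k\ge2$ and $M,N\ge2k-3$, $\mathcal{B}$ satisfies $(\mathrm{HFC})_k$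 with size $(M,N)$ if for every $\mathcal{B}$-admissible pattern $U$ on $\mathcal{A}_{M\times N}$ that can be extended to a $\mathcal{B}$-admissible pattern on the (larger) annular lattice $\mathcal{A}_{(M+4-2k)\times(N+4-2k);k}((k-2,k-2))$, there is a $\mathcal{B}$-admissible pattern on the full rectangle $\mathbb{Z}_{(M+4)\times(N+4)}((-2,-2))$ whose restriction to $\mathcal{A}_{M\times N}$ is $U$. Strong specification. $\Pi_R$ denotes restriction to $R\subset\mathbb{Z}^2$, $\Pi_R(\Sigma)$ its image on $\Sigma$, and $d$ Euclidean distance. $\Sigma\subset\mathcal{S}_p^{\mathbb{Z}^2}$ has strong specification if there is a number $M(\Sigma)\ge1$ such that for any subsets $R_1,R_2\subset\mathbb{Z}^2$ (finite or infinite) with $d(R_1,R_2)\ge M(\Sigma)$ and any $U_1\in\Pi_{R_1}(\Sigma)$, $U_2\in\Pi_{R_2}(\Sigma)$, there is $W\in\Sigma$ with $\Pi_{R_1}(W)=U_1$ and $\Pi_{R_2}(W)=U_2$. *)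

theory Defs
  imports
    "Jordan_Normal_Form.Matrix"
    "HOL-Analysis.Product_Vector"
    "HOL-Library.Extended_Real"
    "HOL-Library.FuncSet"
begin

text \<open>A pattern on \<open>R\<close> is an extensional function on \<open>R\<close>, so that equality of patterns is
  equality of functions and restriction to a sublattice is \<^const>\<open>restrict\<close>.\<close>

type_synonym pattern = "int \<times> int \<Rightarrow> nat"

definition rect :: "nat \<Rightarrow> nat \<Rightarrow> int \<times> int \<Rightarrow> (int \<times> int) set" where
  "rect m n = (\<lambda>(i, j). {i..<i + int m} \<times> {j..<j + int n})"

definition patterns :: "nat \<Rightarrow> (int \<times> int) set \<Rightarrow> pattern set" where
  "patterns p R = R \<rightarrow>\<^sub>E {..<p}"

definition translate_restrict :: "pattern \<Rightarrow> int \<times> int \<Rightarrow> pattern" where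
  "translate_restrict U = (\<lambda>(i, j). restrict (\<lambda>(s, t). U (i + s, j + t)) (rect 2 2 (0, 0)))"

definition admissible :: "nat \<Rightarrow> pattern set \<Rightarrow> (int \<times> int) set \<Rightarrow> pattern set" where
  "admissible p B R =
     {U \<in> patterns p R. \<forall>i j. rect 2 2 (i, j) \<subseteq> R \<longrightarrow> translate_restrict U (i, j) \<in> B}"

abbreviation shift_space :: "nat \<Rightarrow> pattern set \<Rightarrow> pattern set" where
  "shift_space p B \<equiv> admissible p B UNIV"

definition psi :: "nat \<Rightarrow> nat \<Rightarrow> (nat \<Rightarrow> nat) \<Rightarrow> nat" where
  "psi p n u = 1 + (\<Sum>k = 1..n. u k * p ^ (n - k))"

text \<open>The counting function \<^const>\<open>psi\<close> takes values in \<open>{1..p ^ n}\<close>, whereas matrix indices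
  start at 0; hence the \<open>Suc\<close> on the indices below. Since \<^const>\<open>psi\<close> is a bijection from words of
  length \<open>n\<close>, at most one pattern corresponds to each pair of indices. The \<open>k\<close>-th letter of the
  word, counted from 1, sits at coordinate \<open>k - 1\<close>.\<close>

definition H_mat :: "nat \<Rightarrow> pattern set \<Rightarrow> nat \<Rightarrow> nat mat" where
  "H_mat p B n = mat (p ^ n) (p ^ n) (\<lambda>(i, j).
     if \<exists>U \<in> admissible p B (rect 2 n (0, 0)).
          Suc i = psi p n (\<lambda>k. U (0, int k - 1)) \<and>
          Suc j = psi p n (\<lambda>k. U (1, int k - 1))
     then 1 else 0)"

definition V_mat :: "nat \<Rightarrow> pattern set \<Rightarrow> nat \<Rightarrow> nat mat" where
  "V_mat p B n = mat (p ^ n) (p ^ n) (\<lambda>(i, j).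
     if \<exists>U \<in> admissible p B (rect n 2 (0, 0)).
          Suc i = psi p n (\<lambda>k. U (int k - 1, 0)) \<and>
          Suc j = psi p n (\<lambda>k. U (int k - 1, 1))
     then 1 else 0)"

definition nonzero_rows :: "nat mat \<Rightarrow> nat set" where
  "nonzero_rows A = {i. i < dim_row A \<and> row A i \<noteq> 0\<^sub>v (dim_col A)}"

definition nonzero_cols :: "nat mat \<Rightarrow> nat set" where
  "nonzero_cols A = {j. j < dim_col A \<and> col A j \<noteq> 0\<^sub>v (dim_row A)}"

definition weakly_primitive :: "nat \<Rightarrow> nat mat \<Rightarrow> bool" where
  "weakly_primitive N A \<longleftrightarrow>
     (\<forall>n \<ge> N. \<forall>i \<in> nonzero_rows A. \<forall>j \<in> nonzero_cols A. (A ^\<^sub>m n) $$ (i, j) > 0)"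

definition annulus :: "nat \<Rightarrow> nat \<Rightarrow> nat \<Rightarrow> int \<times> int \<Rightarrow> (int \<times> int) set" where
  "annulus M N d = (\<lambda>(i, j).
     rect (M + 2 * d) (N + 2 * d) (i - int d, j - int d) - rect M N (i, j))"

text \<open>Meaningful for \<open>k \<ge> 2\<close> and \<open>M, N \<ge> 2 * k - 3\<close>; none of the subtractions then truncates.\<close>

definition HFC :: "nat \<Rightarrow> pattern set \<Rightarrow> nat \<Rightarrow> nat \<Rightarrow> nat \<Rightarrow> bool" where
  "HFC p B k M N \<longleftrightarrow>
     (\<forall>U \<in> admissible p B (annulus M N 2 (0, 0)).
        (\<exists>V \<in> admissible p B
                (annulus (M + 4 - 2 * k) (N + 4 - 2 * k) k (int k - 2, int k - 2)).
            restrict V (annulus M N 2 (0, 0)) = U) \<longrightarrow>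
        (\<exists>W \<in> admissible p B (rect (M + 4) (N + 4) (-2, -2)).
            restrict W (annulus M N 2 (0, 0)) = U))"

text \<open>The distance is an infimum in \<^typ>\<open>ereal\<close>, so it is infinite if one of the sets is empty.
  The metric on \<^typ>\<open>real \<times> real\<close> is the Euclidean one.\<close>

definition lattice_dist :: "(int \<times> int) set \<Rightarrow> (int \<times> int) set \<Rightarrow> ereal" where
  "lattice_dist R1 R2 = (INF (a, b) \<in> R1. INF (c, d) \<in> R2.
     ereal (dist (real_of_int a, real_of_int b) (real_of_int c, real_of_int d)))"

definition proj :: "(int \<times> int) set \<Rightarrow> pattern set \<Rightarrow> pattern set" where
  "proj R \<Sigma> = (\<lambda>W. restrict W R) ` \<Sigma>"

definition strong_specification :: "pattern set \<Rightarrow> bool" where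
  "strong_specification \<Sigma> \<longleftrightarrow>
     (\<exists>M::real. M \<ge> 1 \<and>
       (\<forall>R1 R2. lattice_dist R1 R2 \<ge> ereal M \<longrightarrow>
         (\<forall>U1 \<in> proj R1 \<Sigma>. \<forall>U2 \<in> proj R2 \<Sigma>.
           \<exists>W \<in> \<Sigma>. restrict W R1 = U1 \<and> restrict W R2 = U2)))"

end

theory Submission
  imports Defs
begin

text \<open>Cover the plane by a grid of horizontal and vertical bands of width \<open>k\<close>, with periods
  \<open>M + 4 - k\<close> and \<open>N + 4 - k\<close>, so that each hole and its surrounding annulus (a cell) fit the
  hole-filling condition. Given two global patterns \<open>W\<^sub>1\<close> and \<open>W\<^sub>2\<close>, put \<open>W\<^sub>1\<close> on those crossings of
  the bands that belong to a cell meeting \<open>R\<^sub>1\<close> and \<open>W\<^sub>2\<close> on the others. Weak primitivity fills the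
  edges between crossings. A cell whose four corners come from the same global pattern is filled
  with that pattern, and if \<open>R\<^sub>1\<close> and \<open>R\<^sub>2\<close> are far apart, no other cell meets \<open>R\<^sub>1 \<union> R\<^sub>2\<close>. The other
  cells are filled by the hole-filling condition. This may change the bands too, but keeps the
  outermost frame of width 2 of the cell and thus admissibility of the whole, so it can be done
  successively for the four parity classes of cells; cells in one class are disjoint.\<close>

section \<open>Patterns as total functions\<close>

text \<open>Dropping extensionality lets one total function be tested on many regions and altered
  pointwise; \<open>restrict_admissible_iff\<close> leads back to \<open>admissible\<close>.\<close>

definition valid_on :: "nat \<Rightarrow> pattern set \<Rightarrow> (int \<times> int) set \<Rightarrow> pattern \<Rightarrow> bool" where
  "valid_on p B R Z \<longleftrightarrow> (\<forall>q \<in> R. Z q < p) \<and>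
     (\<forall>i j. rect 2 2 (i, j) \<subseteq> R \<longrightarrow> translate_restrict Z (i, j) \<in> B)"

lemma mem_rect [simp]:
  "(x, y) \<in> rect m n (i, j) \<longleftrightarrow> i \<le> x \<and> x < i + int m \<and> j \<le> y \<and> y < j + int n"
  by (auto simp: rect_def)

lemma rect_2_2_subset_iff:
  "rect 2 2 (i, j) \<subseteq> R \<longleftrightarrow> {(i, j), (i + 1, j), (i, j + 1), (i + 1, j + 1)} \<subseteq> R"
proof -
  have "rect 2 2 (i, j) = {(i, j), (i + 1, j), (i, j + 1), (i + 1, j + 1)}"
    by (auto simp: rect_def)
  then show ?thesis by simp
qed

lemma translate_restrict_cong:
  assumes "\<And>q. q \<in> rect 2 2 (i, j) \<Longrightarrow> Z q = Z' q"
  shows "translate_restrict Z (i, j) = translate_restrict Z' (i, j)"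
  unfolding translate_restrict_def
  by (auto simp: restrict_def fun_eq_iff intro!: assms)

lemma translate_restrict_shift:
  "translate_restrict (\<lambda>(x, y). Z (x + a, y + b)) (i, j) = translate_restrict Z (i + a, j + b)"
  by (auto simp: translate_restrict_def restrict_def fun_eq_iff algebra_simps)

lemma valid_on_cong:
  assumes "\<And>q. q \<in> R \<Longrightarrow> Z q = Z' q"
  shows "valid_on p B R Z \<longleftrightarrow> valid_on p B R Z'"
proof -
  have "translate_restrict Z (i, j) = translate_restrict Z' (i, j)" if "rect 2 2 (i, j) \<subseteq> R" for i j
    using that by (intro translate_restrict_cong assms) auto
  then show ?thesis using assms by (simp add: valid_on_def)
qed

lemma valid_on_mono: "valid_on p B R Z \<Longrightarrow> S \<subseteq> R \<Longrightarrow> valid_on p B S Z"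
  unfolding valid_on_def by blast

lemma admissible_iff_valid_on: "U \<in> admissible p B R \<longleftrightarrow> valid_on p B R U \<and> U \<in> extensional R"
  by (auto simp: admissible_def patterns_def valid_on_def PiE_def Pi_def)

lemma restrict_admissible_iff: "restrict Z R \<in> admissible p B R \<longleftrightarrow> valid_on p B R Z"
  using valid_on_cong[of R "restrict Z R" Z] by (simp add: admissible_iff_valid_on)

lemma mem_shift_image:
  fixes a b :: int
  shows "(x, y) \<in> (\<lambda>(x, y). (x + a, y + b)) ` R \<longleftrightarrow> (x - a, y - b) \<in> R"
  by (auto intro!: image_eqI[of _ _ "(x - a, y - b)"])

lemma valid_on_shift:
  "valid_on p B R (\<lambda>(x, y). Z (x + a, y + b)) \<longleftrightarrow>
   valid_on p B ((\<lambda>(x, y). (x + a, y + b)) ` R) Z" (is "?l \<longleftrightarrow> valid_on p B (?s ` R) Z")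
proof -
  have "(\<forall>i j. rect 2 2 (i, j) \<subseteq> R \<longrightarrow> translate_restrict Z (i + a, j + b) \<in> B) \<longleftrightarrow>
        (\<forall>i j. rect 2 2 (i - a, j - b) \<subseteq> R \<longrightarrow> translate_restrict Z (i, j) \<in> B)"
    by (metis add_diff_cancel diff_add_cancel)
  moreover have "rect 2 2 (i - a, j - b) \<subseteq> R \<longleftrightarrow> rect 2 2 (i, j) \<subseteq> ?s ` R" for i j
    by (simp add: rect_2_2_subset_iff mem_shift_image algebra_simps)
  ultimately show ?thesis
    unfolding valid_on_def translate_restrict_shift by auto
qed

section \<open>Base-\<open>p\<close> words and walks in the transition matrices\<close>

lemma psi_le:
  assumes "\<And>k. k \<in> {1..n} \<Longrightarrow> u k < p"
  shows "psi p n u \<le> p ^ n"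
  using assms
proof (induction n)
  case 0
  then show ?case by (simp add: psi_def)
next
  case (Suc n)
  have "(\<Sum>k = 1..n. u k * p ^ (Suc n - k)) = p * (\<Sum>k = 1..n. u k * p ^ (n - k))"
    by (simp add: sum_distrib_left Suc_diff_le mult.left_commute)
  then have eq: "psi p (Suc n) u = 1 + p * (psi p n u - 1) + u (Suc n)"
    by (simp add: psi_def)
  have "psi p n u - 1 + 1 \<le> p ^ n" using Suc by (simp add: psi_def)
  then have "p * (psi p n u - 1 + 1) \<le> p * p ^ n" by (rule mult_le_mono2)
  then have "p * (psi p n u - 1) + p \<le> p * p ^ n" by simp
  with Suc.prems[of "Suc n"] show ?case by (simp add: eq)
qed

text \<open>One less than \<open>psi\<close> is a base-\<open>p\<close> number: its remainder modulo
  \<open>p\<close> gives the last letter, its quotient the value of the remaining word. Subtracting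
  1 is harmless as \<open>psi\<close> is at least 1.\<close>

lemma psi_inj:
  assumes "psi p n u = psi p n v"
    and "\<And>k. k \<in> {1..n} \<Longrightarrow> u k < p" "\<And>k. k \<in> {1..n} \<Longrightarrow> v k < p"
  shows "\<forall>k \<in> {1..n}. u k = v k"
  using assms
proof (induction n)
  case 0
  then show ?case by simp
next
  case (Suc n)
  have eq: "psi p (Suc n) w = 1 + (w (Suc n) + p * (psi p n w - 1))" for w
  proof -
    have "(\<Sum>k = 1..n. w k * p ^ (Suc n - k)) = p * (\<Sum>k = 1..n. w k * p ^ (n - k))"
      by (simp add: sum_distrib_left Suc_diff_le mult.left_commute)
    then show ?thesis by (simp add: psi_def)
  qed
  have lt: "u (Suc n) < p" "v (Suc n) < p" using Suc.prems(2,3) by auto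
  have e: "u (Suc n) + p * (psi p n u - 1) = v (Suc n) + p * (psi p n v - 1)"
    using Suc.prems(1) by (simp add: eq)
  have last: "u (Suc n) = v (Suc n)"
    using arg_cong[OF e, of "\<lambda>t. t mod p"] lt by simp
  with e lt have "psi p n u - 1 = psi p n v - 1" by simp
  moreover have "psi p n u \<ge> 1" "psi p n v \<ge> 1" by (simp_all add: psi_def)
  ultimately have "psi p n u = psi p n v" by linarith
  with Suc have "\<forall>k \<in> {1..n}. u k = v k" by simp
  with last show ?case by (auto simp: le_Suc_eq)
qed

text \<open>An entry of a matrix product is a sum of natural numbers, so a positive entry has a
  positive summand; its index is the last but one vertex of the walk.\<close>

lemma pow_mat_pos_imp_walk:
  fixes A :: "nat mat"
  assumes "A \<in> carrier_mat n n" "i < n" "j < n" "(A ^\<^sub>m m) $$ (i, j) > 0"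
  shows "\<exists>f. f 0 = i \<and> f m = j \<and> (\<forall>t \<le> m. f t < n) \<and> (\<forall>t < m. A $$ (f t, f (Suc t)) > 0)"
  using assms(3,4)
proof (induction m arbitrary: j)
  case 0
  then have "i = j" using assms by (auto simp: one_mat_def split: if_splits)
  then show ?case using assms by (intro exI[of _ "\<lambda>_. i"]) simp
next
  case (Suc m)
  have "(A ^\<^sub>m Suc m) $$ (i, j) = (\<Sum>l = 0..<n. (A ^\<^sub>m m) $$ (i, l) * A $$ (l, j))"
    using assms(1,2) Suc.prems(1) pow_carrier_mat[OF assms(1), of m]
    by (simp add: scalar_prod_def)
  with Suc.prems(2) have "(\<Sum>l = 0..<n. (A ^\<^sub>m m) $$ (i, l) * A $$ (l, j)) \<noteq> 0"
    by (metis less_irrefl)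
  then obtain l where l: "l < n" "(A ^\<^sub>m m) $$ (i, l) * A $$ (l, j) > 0"
    by (elim sum.not_neutral_contains_not_neutral) simp
  then obtain f where f: "f 0 = i" "f m = l" "\<forall>t \<le> m. f t < n" "\<forall>t < m. A $$ (f t, f (Suc t)) > 0"
    using Suc.IH[of l] by auto
  show ?case
    using f l Suc.prems(1) by (intro exI[of _ "f(Suc m := j)"]) (auto simp: less_Suc_eq le_Suc_eq)
qed

text \<open>Rows and columns of \<open>A\<close> are numbered by words, so a positive entry of the
  \<open>m\<close>-th power gives a walk through words, and injectivity of \<open>psi\<close>
  decodes it. \<open>U0\<close> witnesses a nonzero row and \<open>U1\<close> a nonzero column, as
  weak primitivity demands.\<close>

lemma primitive_word_path:
  fixes p n :: nat and S :: "'a set" and f g :: "'a \<Rightarrow> int \<Rightarrow> nat"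
  defines "A \<equiv> mat (p ^ n) (p ^ n) (\<lambda>(i, j).
     if \<exists>U \<in> S. Suc i = psi p n (\<lambda>k. f U (int k - 1)) \<and> Suc j = psi p n (\<lambda>k. g U (int k - 1))
     then 1 else (0 :: nat))"
  assumes digits: "\<And>U s. U \<in> S \<Longrightarrow> s \<in> {0..<int n} \<Longrightarrow> f U s < p \<and> g U s < p"
    and prim: "weakly_primitive m A" and m: "m > 0"
    and U: "U0 \<in> S" "U1 \<in> S"
  shows "\<exists>c. (\<forall>s \<in> {0..<int n}. c 0 s = f U0 s \<and> c m s = g U1 s) \<and>
     (\<forall>t < m. \<exists>U \<in> S. \<forall>s \<in> {0..<int n}. f U s = c t s \<and> g U s = c (Suc t) s)"
proof -
  define F where "F U = psi p n (\<lambda>k. f U (int k - 1)) - 1" for U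
  define G where "G U = psi p n (\<lambda>k. g U (int k - 1)) - 1" for U
  have pos: "psi p n u > 0" for u by (simp add: psi_def)
  have lt: "F U < p ^ n" "G U < p ^ n" if "U \<in> S" for U
    using psi_le[of n "\<lambda>k. f U (int k - 1)" p] psi_le[of n "\<lambda>k. g U (int k - 1)" p]
      digits[OF that] pos[of "\<lambda>k. f U (int k - 1)"] pos[of "\<lambda>k. g U (int k - 1)"]
    unfolding F_def G_def by fastforce+
  have A: "A \<in> carrier_mat (p ^ n) (p ^ n)" by (simp add: A_def)
  have Aij: "A $$ (i, j) = (if \<exists>U \<in> S. i = F U \<and> j = G U then 1 else 0)"
    if "i < p ^ n" "j < p ^ n" for i j
  proof -
    have "Suc i = psi p n u \<longleftrightarrow> i = psi p n u - 1" for i u using pos[of u] by auto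
    then show ?thesis using that by (simp add: A_def F_def G_def)
  qed
  have inj: "u s = v s"
    if "psi p n (\<lambda>k. u (int k - 1)) - 1 = psi p n (\<lambda>k. v (int k - 1)) - 1"
      and "\<forall>s \<in> {0..<int n}. u s < p" "\<forall>s \<in> {0..<int n}. v s < p" and s: "s \<in> {0..<int n}"
    for u v s
  proof -
    have "psi p n (\<lambda>k. u (int k - 1)) = psi p n (\<lambda>k. v (int k - 1))"
      using that(1) pos by (metis Suc_diff_1)
    from psi_inj[OF this] that(2,3) have "\<forall>k \<in> {1..n}. u (int k - 1) = v (int k - 1)" by simp
    moreover have "nat (s + 1) \<in> {1..n}" "int (nat (s + 1)) - 1 = s" using s by auto
    ultimately show ?thesis by metis
  qed
  have "F U0 \<in> nonzero_rows A"
  proof -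
    have "row A (F U0) $ G U0 \<noteq> 0\<^sub>v (p ^ n) $ G U0"
      using lt[OF U(1)] A Aij[of "F U0" "G U0"] U(1) by auto
    then have "row A (F U0) \<noteq> 0\<^sub>v (p ^ n)" by metis
    then show ?thesis using lt[OF U(1)] A by (simp add: nonzero_rows_def)
  qed
  moreover have "G U1 \<in> nonzero_cols A"
  proof -
    have "col A (G U1) $ F U1 \<noteq> 0\<^sub>v (p ^ n) $ F U1"
      using lt[OF U(2)] A Aij[of "F U1" "G U1"] U(2) by auto
    then have "col A (G U1) \<noteq> 0\<^sub>v (p ^ n)" by metis
    then show ?thesis using lt[OF U(2)] A by (simp add: nonzero_cols_def)
  qed
  ultimately have "(A ^\<^sub>m m) $$ (F U0, G U1) > 0"
    using prim by (simp add: weakly_primitive_def)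
  then obtain h where h: "h 0 = F U0" "h m = G U1" "\<forall>t \<le> m. h t < p ^ n"
    "\<forall>t < m. A $$ (h t, h (Suc t)) > 0"
    using pow_mat_pos_imp_walk[OF A lt(1)[OF U(1)] lt(2)[OF U(2)], of m] by blast
  have "\<forall>t < m. \<exists>U \<in> S. h t = F U \<and> h (Suc t) = G U"
  proof (intro allI impI)
    fix t assume "t < m"
    with h(3,4) have "h t < p ^ n" "h (Suc t) < p ^ n" "A $$ (h t, h (Suc t)) > 0" by auto
    then show "\<exists>U \<in> S. h t = F U \<and> h (Suc t) = G U" by (simp add: Aij split: if_splits)
  qed
  then obtain V where V: "\<And>t. t < m \<Longrightarrow> V t \<in> S \<and> h t = F (V t) \<and> h (Suc t) = G (V t)"
    by metis
  \<comment> \<open>The word at vertex \<open>t\<close> is read off the edge leaving it; the last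
    vertex has no such edge and takes its word from \<open>U1\<close>.\<close>
  define c where "c t = (if t < m then f (V t) else g U1)" for t
  \<comment> \<open>The edges \<open>V t\<close> and \<open>V (Suc t)\<close> meet in a vertex, and
    equal vertex numbers mean equal words.\<close>
  have step: "f (V t) s = c t s \<and> g (V t) s = c (Suc t) s" if t: "t < m" and s: "s \<in> {0..<int n}" for t s
  proof (cases "Suc t < m")
    case True
    then have "F (V (Suc t)) = G (V t)" using V[of t] V[of "Suc t"] t by simp
    then have "f (V (Suc t)) s = g (V t) s"
      unfolding F_def G_def using V[of t] V[of "Suc t"] t True s digits by (intro inj[of "f (V (Suc t))" "g (V t)"]) auto
    then show ?thesis using t True by (simp add: c_def)
  next
    case False
    then have "Suc t = m" using t by simp
    then have "G (V t) = G U1" using V[of t] t h by simp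
    then have "g (V t) s = g U1 s"
      unfolding G_def using V[of t] t s U digits by (intro inj[of "g (V t)" "g U1"]) auto
    then show ?thesis using t False by (simp add: c_def)
  qed
  have "c 0 s = f U0 s \<and> c m s = g U1 s" if s: "s \<in> {0..<int n}" for s
  proof -
    have "F (V 0) = F U0" using V[of 0] h m by simp
    then have "f (V 0) s = f U0 s"
      unfolding F_def using V[of 0] m s U digits by (intro inj[of "f (V 0)" "f U0"]) auto
    then show ?thesis using m by (simp add: c_def)
  qed
  moreover have "\<forall>t < m. \<exists>U \<in> S. \<forall>s \<in> {0..<int n}. f U s = c t s \<and> g U s = c (Suc t) s"
  proof (intro allI impI)
    fix t assume "t < m"
    then show "\<exists>U \<in> S. \<forall>s \<in> {0..<int n}. f U s = c t s \<and> g U s = c (Suc t) s"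
      using V[of t] step[of t] by (intro bexI[of _ "V t"]) auto
  qed
  ultimately show ?thesis by (intro exI[of _ c]) simp
qed

section \<open>Joining two global patterns inside a band\<close>

text \<open>The walk runs through columns of height \<open>k\<close>, from column \<open>x\<close>
  of \<open>W1\<close> to column \<open>x + m\<close> of \<open>W2\<close>. As both patterns are
  global, the first column has an admissible successor and the last one an admissible predecessor,
  so their indices belong to a nonzero row and a nonzero column.\<close>

lemma horizontal_strip:
  assumes prim: "weakly_primitive m (H_mat p B k)" and m: "m > 0"
    and W: "valid_on p B UNIV W1" "valid_on p B UNIV W2"
  shows "\<exists>Z. valid_on p B (UNIV \<times> {y..<y + int k}) Z \<and>
    (\<forall>a b. a \<le> x \<longrightarrow> Z (a, b) = W1 (a, b)) \<and> (\<forall>a b. x + int m \<le> a \<longrightarrow> Z (a, b) = W2 (a, b))"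
proof -
  define S where "S = admissible p B (rect 2 k (0, 0))"
  have S: "restrict (\<lambda>(s, t). W (s + a, t + y)) (rect 2 k (0, 0)) \<in> S" if "valid_on p B UNIV W" for W a
    unfolding S_def restrict_admissible_iff valid_on_shift using that valid_on_mono by blast
  have digits: "U (0, s) < p \<and> U (1, s) < p" if "U \<in> S" "s \<in> {0..<int k}" for U s
    using that by (auto simp: S_def admissible_iff_valid_on valid_on_def)
  \<comment> \<open>The second window starts at \<open>x + m - 1\<close> so that its right column,
    the end of the walk, is column \<open>x + m\<close>.\<close>
  have "\<exists>c. (\<forall>s \<in> {0..<int k}. c 0 s = W1 (x, s + y) \<and> c m s = W2 (x + int m, s + y)) \<and>
    (\<forall>t < m. \<exists>U \<in> S. \<forall>s \<in> {0..<int k}. U (0, s) = c t s \<and> U (1, s) = c (Suc t) s)"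
    using primitive_word_path[where S = S and f = "\<lambda>U s. U (0, s)" and g = "\<lambda>U s. U (1, s)" and p = p
        and n = k and m = m, OF digits _ m S[OF W(1), of x] S[OF W(2), of "x + int m - 1"]]
      prim unfolding H_mat_def S_def[symmetric] by (auto simp: algebra_simps)
  then obtain c where
    "\<forall>s \<in> {0..<int k}. c 0 s = W1 (x, s + y) \<and> c m s = W2 (x + int m, s + y)"
    "\<forall>t < m. \<exists>U \<in> S. \<forall>s \<in> {0..<int k}. U (0, s) = c t s \<and> U (1, s) = c (Suc t) s"
    by blast
  note c = this[rule_format]
  define Z where "Z = (\<lambda>(a, b). if a \<le> x then W1 (a, b) else if x + int m \<le> a then W2 (a, b)
    else c (nat (a - x)) (b - y))"
  have left: "Z (a, b) = W1 (a, b)" if "a \<le> x" for a b using that by (simp add: Z_def)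
  have right: "Z (a, b) = W2 (a, b)" if "x + int m \<le> a" for a b using that m by (simp add: Z_def)
  \<comment> \<open>This includes both ends \<open>t = 0\<close> and \<open>t = m\<close>, so
    windows across the seams need no separate treatment.\<close>
  have mid: "Z (x + int t, b) = c t (b - y)" if "t \<le> m" "b \<in> {y..<y + int k}" for t b
    using that c(1)[of "b - y"] by (cases "t = 0 \<or> t = m") (auto simp: Z_def)
  have "Z (a, b) < p" if "b \<in> {y..<y + int k}" for a b
  proof -
    consider "a \<le> x" | "x + int m \<le> a" | t where "t < m" "a = x + int t"
      using zle_iff_zadd[of x a] by force
    then show ?thesis
    proof cases
      case 3
      obtain U where "U \<in> S" "\<forall>s \<in> {0..<int k}. U (0, s) = c t s \<and> U (1, s) = c (Suc t) s"
        using c(2)[OF 3(1)] by metis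
      with digits[of U "b - y"] mid[of t b] that 3 show ?thesis by auto
    qed (use W left right in \<open>auto simp: valid_on_def\<close>)
  qed
  moreover have "translate_restrict Z (i, j) \<in> B"
    if "rect 2 2 (i, j) \<subseteq> UNIV \<times> {y..<y + int k}" for i j
  proof -
    have j: "y \<le> j" "j + 1 < y + int k" using that by (auto simp: rect_2_2_subset_iff)
    have WB: "translate_restrict W (i, j) \<in> B" if "valid_on p B UNIV W" for W
      using that by (simp add: valid_on_def)
    consider "i + 1 \<le> x" | "x + int m \<le> i" | t where "t < m" "i = x + int t"
      using zle_iff_zadd[of x i] by force
    then show ?thesis
    proof cases
      case 1
      then have "translate_restrict Z (i, j) = translate_restrict W1 (i, j)"
        by (intro translate_restrict_cong) (auto simp: rect_def left)
      with WB W show ?thesis by simp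
    next
      case 2
      then have "translate_restrict Z (i, j) = translate_restrict W2 (i, j)"
        by (intro translate_restrict_cong) (auto simp: rect_def right)
      with WB W show ?thesis by simp
    next
      case 3
      obtain U where U: "U \<in> S" "\<And>s. s \<in> {0..<int k} \<Longrightarrow> U (0, s) = c t s \<and> U (1, s) = c (Suc t) s"
        using c(2)[OF 3(1)] by metis
      \<comment> \<open>The patterns of the walk start at height 0 and the band at height
        \<open>y\<close>, so height \<open>j\<close> in the plane is height \<open>j - y\<close> in
        \<open>U\<close>.\<close>
      have "translate_restrict (\<lambda>(a, b). Z (a + i, b + j)) (0, 0) =
            translate_restrict (\<lambda>(a, b). U (a + 0, b + (j - y))) (0, 0)"
      proof (intro translate_restrict_cong)
        fix q :: "int \<times> int" assume "q \<in> rect 2 2 (0, 0)"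
        moreover obtain a b where q: "q = (a, b)" by force
        ultimately have b: "a = 0 \<or> a = 1" "0 \<le> b" "b \<le> 1" by auto
        then have "b + j - y \<in> {0..<int k}" "b + j \<in> {y..<y + int k}" using j by auto
        then show "(case q of (a, b) \<Rightarrow> Z (a + i, b + j)) = (case q of (a, b) \<Rightarrow> U (a + 0, b + (j - y)))"
          using q b U(2)[of "b + j - y"] mid[of t "b + j"] mid[of "Suc t" "b + j"] 3
          by (auto simp: algebra_simps)
      qed
      moreover have "translate_restrict U (0, j - y) \<in> B"
        using U(1) j by (auto simp: S_def admissible_iff_valid_on valid_on_def rect_2_2_subset_iff)
      ultimately show ?thesis unfolding translate_restrict_shift by simp
    qed
  qed
  ultimately have "valid_on p B (UNIV \<times> {y..<y + int k}) Z" by (auto simp: valid_on_def)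
  with left right show ?thesis by blast
qed

text \<open>Reflection in the diagonal exchanges rows and columns, so claims about vertical strips
  become claims about horizontal strips for the set of reflected blocks.\<close>

abbreviation flip :: "pattern \<Rightarrow> pattern" where
  "flip U \<equiv> U \<circ> prod.swap"

lemma translate_restrict_flip: "translate_restrict (flip U) (i, j) = flip (translate_restrict U (j, i))"
  by (auto simp: translate_restrict_def restrict_def fun_eq_iff)

lemma valid_on_flip: "valid_on p (flip ` B) R (flip Z) \<longleftrightarrow> valid_on p B (prod.swap ` R) Z"
proof -
  have mem: "(x, y) \<in> prod.swap ` R \<longleftrightarrow> (y, x) \<in> R" for x y by force
  have "inj flip" by (rule injI) (metis comp_assoc comp_id swap_comp_swap)
  then have "flip U \<in> flip ` B \<longleftrightarrow> U \<in> B" for U by (rule inj_image_mem_iff)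
  moreover have "rect 2 2 (j, i) \<subseteq> prod.swap ` R \<longleftrightarrow> rect 2 2 (i, j) \<subseteq> R" for i j
    by (auto simp: rect_2_2_subset_iff mem)
  ultimately show ?thesis unfolding valid_on_def translate_restrict_flip by auto
qed

lemma V_mat_eq_H_mat_flip: "V_mat p B n = H_mat p (flip ` B) n"
proof -
  have swap_rect: "prod.swap ` rect a b (0, 0) = rect b a (0, 0)" for a b
    by (force simp: rect_def)
  have flip: "flip (flip U) = U" for U by (simp add: comp_assoc)
  have adm: "flip U \<in> admissible p (flip ` B) (rect 2 n (0, 0)) \<longleftrightarrow> U \<in> admissible p B (rect n 2 (0, 0))" for U
    unfolding admissible_iff_valid_on valid_on_flip swap_rect by (auto simp: extensional_def)
  have "(\<exists>U \<in> admissible p B (rect n 2 (0, 0)). P U) \<longleftrightarrow>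
        (\<exists>U \<in> admissible p (flip ` B) (rect 2 n (0, 0)). P (flip U))" for P
    using adm flip by metis
  then show ?thesis unfolding V_mat_def H_mat_def by simp
qed

lemma vertical_strip:
  assumes "weakly_primitive m (V_mat p B k)" "m > 0"
    "valid_on p B UNIV W1" "valid_on p B UNIV W2"
  shows "\<exists>Z. valid_on p B ({x..<x + int k} \<times> UNIV) Z \<and>
    (\<forall>a b. b \<le> y \<longrightarrow> Z (a, b) = W1 (a, b)) \<and> (\<forall>a b. y + int m \<le> b \<longrightarrow> Z (a, b) = W2 (a, b))"
proof -
  have "valid_on p (flip ` B) UNIV (flip W)" if "valid_on p B UNIV W" for W
    using that by (simp add: valid_on_flip)
  with assms horizontal_strip[of m p "flip ` B" k "flip W1" "flip W2" x y]
  obtain Z where Z: "valid_on p (flip ` B) (UNIV \<times> {x..<x + int k}) Z"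
    "\<And>a b. a \<le> y \<Longrightarrow> Z (a, b) = flip W1 (a, b)" "\<And>a b. y + int m \<le> a \<Longrightarrow> Z (a, b) = flip W2 (a, b)"
    by (auto simp: V_mat_eq_H_mat_flip)
  have "Z = flip (flip Z)" by (simp add: comp_assoc)
  with Z(1) have "valid_on p (flip ` B) (UNIV \<times> {x..<x + int k}) (flip (flip Z))" by simp
  then have "valid_on p B ({x..<x + int k} \<times> UNIV) (flip Z)"
    by (simp only: valid_on_flip product_swap)
  with Z(2,3) show ?thesis by (intro exI[of _ "flip Z"]) auto
qed

section \<open>Filling holes\<close>

text \<open>This moves the hole-filling condition to a cell with lower left corner
  \<open>(a, b)\<close>. The outer boundary of the thick annulus is that of the cell, so
  \<open>Z\<close> on this annulus is the extension that the condition requires. The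
  \<open>M\<close> by \<open>N\<close> hole at \<open>(a + 2, b + 2)\<close> leaves a frame of width
  2 unchanged.\<close>

lemma HFC_fill:
  assumes "HFC p B k M N" "k \<ge> 2" "M \<ge> 2 * k - 3" "N \<ge> 2 * k - 3"
    and Z: "valid_on p B (annulus (M + 4 - 2 * k) (N + 4 - 2 * k) k (a + int k, b + int k)) Z"
  shows "\<exists>Z'. valid_on p B (rect (M + 4) (N + 4) (a, b)) Z' \<and>
    (\<forall>q \<in> rect (M + 4) (N + 4) (a, b) - rect M N (a + 2, b + 2). Z' q = Z q)"
proof -
  let ?A = "annulus M N 2 (0, 0)"
  let ?T = "annulus (M + 4 - 2 * k) (N + 4 - 2 * k) k (int k - 2, int k - 2)"
  let ?R = "rect (M + 4) (N + 4) (-2, -2)"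
  define Y where "Y = (\<lambda>(x, y). Z (x + (a + 2), y + (b + 2)))"
  have sub: "?A \<subseteq> ?T" "?A = ?R - rect M N (0, 0)" "?A \<subseteq> ?R"
    using assms(2-4) by (auto simp: annulus_def)
  have "(\<lambda>(x, y). (x + (a + 2), y + (b + 2))) ` ?T =
      annulus (M + 4 - 2 * k) (N + 4 - 2 * k) k (a + int k, b + int k)"
    by (auto simp: annulus_def mem_shift_image)
  with Z have T: "valid_on p B ?T Y" by (simp only: Y_def valid_on_shift)
  have "restrict Y ?T \<in> admissible p B ?T" "restrict Y ?A \<in> admissible p B ?A"
    "restrict (restrict Y ?T) ?A = restrict Y ?A"
    using T valid_on_mono[OF T sub(1)] sub(1) by (simp_all add: restrict_admissible_iff Int_absorb1)
  then obtain W where W: "W \<in> admissible p B ?R" "restrict W ?A = restrict Y ?A"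
    using assms(1) unfolding HFC_def by blast
  define Z' where "Z' = (\<lambda>(x, y). W (x + (- a - 2), y + (- b - 2)))"
  have "(\<lambda>(x, y). (x + (- a - 2), y + (- b - 2))) ` rect (M + 4) (N + 4) (a, b) = ?R"
    by (auto simp: mem_shift_image)
  with W(1) have "valid_on p B (rect (M + 4) (N + 4) (a, b)) Z'"
    by (simp only: Z'_def valid_on_shift admissible_iff_valid_on)
  moreover have "Z' (x, y) = Z (x, y)"
    if "(x, y) \<in> rect (M + 4) (N + 4) (a, b) - rect M N (a + 2, b + 2)" for x y
  proof -
    have "(x + (- a - 2), y + (- b - 2)) \<in> ?A" using that by (auto simp: sub(2))
    with W(2) have "W (x + (- a - 2), y + (- b - 2)) = Y (x + (- a - 2), y + (- b - 2))"
      by (metis restrict_apply')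
    then show ?thesis by (simp add: Z'_def Y_def)
  qed
  ultimately show ?thesis by auto
qed

text \<open>Only the hole \<open>I c\<close> of each cell is rewritten. A window meeting a hole
  stays within its cell, where the result is \<open>Y c\<close>; a window missing all holes lies in
  \<open>G\<close>, because the frames do, and sees only \<open>Z\<close>.\<close>

lemma HFC_fill_family:
  assumes hfc: "HFC p B k M N" "k \<ge> 2" "M \<ge> 2 * k - 3" "N \<ge> 2 * k - 3"
    and disj: "\<And>c d. c \<in> C \<Longrightarrow> d \<in> C \<Longrightarrow> c \<noteq> d \<Longrightarrow> rect (M + 4) (N + 4) c \<inter> rect (M + 4) (N + 4) d = {}"
    and Z: "valid_on p B G Z"
    and ann: "\<And>a b. (a, b) \<in> C \<Longrightarrow>
      annulus (M + 4 - 2 * k) (N + 4 - 2 * k) k (a + int k, b + int k) \<subseteq> G"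
  shows "\<exists>Z'. valid_on p B (G \<union> (\<Union>c \<in> C. rect (M + 4) (N + 4) c)) Z' \<and>
    (\<forall>q. q \<notin> (\<Union>c \<in> C. rect (M + 4) (N + 4) c) \<longrightarrow> Z' q = Z q)"
proof -
  let ?R = "rect (M + 4) (N + 4)"
  define I where "I = (\<lambda>(a, b). rect M N (a + 2 :: int, b + 2 :: int))"
  have "\<exists>Y. valid_on p B (?R c) Y \<and> (\<forall>q \<in> ?R c - I c. Y q = Z q)" if "c \<in> C" for c
  proof -
    obtain a b where c: "c = (a, b)" by force
    show ?thesis
      using HFC_fill[OF hfc valid_on_mono[OF Z ann[of a b]]] that by (simp add: c I_def)
  qed
  then obtain Y where Y: "\<And>c. c \<in> C \<Longrightarrow> valid_on p B (?R c) (Y c)"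
    "\<And>c q. c \<in> C \<Longrightarrow> q \<in> ?R c \<Longrightarrow> q \<notin> I c \<Longrightarrow> Y c q = Z q"
    by (metis DiffI)
  have IR: "I c \<subseteq> ?R c" for c by (cases c) (auto simp: I_def)
  \<comment> \<open>The cells are disjoint, so \<open>THE\<close> selects the only hole containing
    \<open>q\<close>.\<close>
  define Z' where "Z' q = (if \<exists>c \<in> C. q \<in> I c then Y (THE c. c \<in> C \<and> q \<in> I c) q else Z q)" for q
  have Z'Y: "Z' q = Y c q" if "c \<in> C" "q \<in> ?R c" for c q
  proof (cases "q \<in> I c")
    case True
    have "d = c" if "d \<in> C" "q \<in> I d" for d
      using disj[of c d] \<open>c \<in> C\<close> \<open>q \<in> ?R c\<close> that IR by blast
    then have "(THE d. d \<in> C \<and> q \<in> I d) = c" using True that by blast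
    then show ?thesis using True that by (auto simp: Z'_def)
  next
    case False
    have "q \<notin> I d" if "d \<in> C" for d
      using disj[of c d] \<open>c \<in> C\<close> \<open>q \<in> ?R c\<close> that IR False by blast
    then show ?thesis using False that Y(2) by (auto simp: Z'_def)
  qed
  have Z'Z: "Z' q = Z q" if "\<And>c. c \<in> C \<Longrightarrow> q \<notin> I c" for q
    using that by (auto simp: Z'_def)
  have ring: "?R c - I c \<subseteq> G" if "c \<in> C" for c
  proof -
    obtain a b where c: "c = (a, b)" by force
    have "?R c - I c \<subseteq> annulus (M + 4 - 2 * k) (N + 4 - 2 * k) k (a + int k, b + int k)"
      using hfc(2-4) by (auto simp: c I_def annulus_def)
    with ann that show ?thesis unfolding c by blast
  qed
  have "Z' q < p" if "q \<in> G \<union> (\<Union>c \<in> C. ?R c)" for q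
  proof (cases "\<exists>c \<in> C. q \<in> ?R c")
    case True
    then obtain c where "c \<in> C" "q \<in> ?R c" by blast
    with Z'Y Y(1)[of c] show ?thesis by (simp add: valid_on_def)
  next
    case False
    then have "Z' q = Z q" using IR by (intro Z'Z) blast
    with False that Z show ?thesis by (auto simp: valid_on_def)
  qed
  moreover have "translate_restrict Z' (i, j) \<in> B" if w: "rect 2 2 (i, j) \<subseteq> G \<union> (\<Union>c \<in> C. ?R c)" for i j
  proof (cases "\<exists>c \<in> C. rect 2 2 (i, j) \<inter> I c \<noteq> {}")
    case True
    then obtain c where c: "c \<in> C" "rect 2 2 (i, j) \<inter> I c \<noteq> {}" by blast
    then have sub: "rect 2 2 (i, j) \<subseteq> ?R c" by (cases c) (auto simp: I_def)
    have "translate_restrict Z' (i, j) = translate_restrict (Y c) (i, j)"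
      using sub c(1) by (intro translate_restrict_cong Z'Y) auto
    with Y(1)[OF c(1)] sub show ?thesis by (simp add: valid_on_def)
  next
    case False
    then have "rect 2 2 (i, j) \<subseteq> G" using w ring by blast
    moreover have "translate_restrict Z' (i, j) = translate_restrict Z (i, j)"
      using False by (intro translate_restrict_cong Z'Z) blast
    ultimately show ?thesis using Z by (simp add: valid_on_def)
  qed
  ultimately have "valid_on p B (G \<union> (\<Union>c \<in> C. ?R c)) Z'" by (simp add: valid_on_def)
  moreover have "Z' q = Z q" if "q \<notin> (\<Union>c \<in> C. ?R c)" for q
    using that IR by (intro Z'Z) blast
  ultimately show ?thesis by blast
qed

section \<open>The grid of bands and its cells\<close>

text \<open>Since \<open>k < P\<close>, consecutive bands are separated by at least one point, so
  neighbouring points in bands lie in the same band.\<close>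

lemma band_adjacent:
  fixes P k x a a' :: int
  assumes "k < P" "a * P \<le> x" "x < a * P + k" "a' * P \<le> x + 1" "x + 1 < a' * P + k"
  shows "x + 1 < a * P + k"
proof -
  have "a' \<le> a"
  proof (rule ccontr)
    assume "\<not> a' \<le> a"
    then have "(a + 1) * P \<le> a' * P" using assms by (intro mult_right_mono) auto
    with assms show False by (simp add: distrib_right)
  qed
  then have "a' * P \<le> a * P" using assms by (intro mult_right_mono) auto
  with assms show ?thesis by linarith
qed

lemma ex_multiple_interval:
  fixes x R :: int
  assumes "R > 0"
  shows "\<exists>c. c * R \<le> x \<and> x < c * R + R"
  using assms pos_mod_bound[of R x] pos_mod_sign[of R x] div_mult_mod_eq[of x R]
  by (intro exI[of _ "x div R"]) linarith

text \<open>\<open>L a b\<close> is the pattern wanted on the crossing at the lower left of cell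
  \<open>(a, b)\<close>; a cell is \<open>pure\<close> if its four crossings want the same pattern.
  Cells overlap in the bands, so filling an impure cell can alter a band of a pure neighbour. Hence
  \<open>Z\<close> is fixed only at points all of whose cells are pure.\<close>

lemma patching:
  fixes L :: "int \<Rightarrow> int \<Rightarrow> pattern"
  assumes k: "k \<ge> 2" "M \<ge> 2 * k - 3" "N \<ge> 2 * k - 3" and hfc: "HFC p B k M N"
    and prim: "weakly_primitive (M + 5 - 2 * k) (H_mat p B k)"
      "weakly_primitive (N + 5 - 2 * k) (V_mat p B k)"
    and L: "\<And>a b. valid_on p B UNIV (L a b)"
  defines "cell a b \<equiv> rect (M + 4) (N + 4) (a * (int M + 4 - int k), b * (int N + 4 - int k))"
    and "pure a b \<equiv> L (a + 1) b = L a b \<and> L a (b + 1) = L a b \<and> L (a + 1) (b + 1) = L a b"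
  shows "\<exists>Z. valid_on p B UNIV Z \<and> (\<forall>q. (\<forall>a b. q \<in> cell a b \<longrightarrow> pure a b) \<longrightarrow>
    (\<forall>a b. q \<in> cell a b \<longrightarrow> Z q = L a b q))"
proof -
  \<comment> \<open>The period is the side of a cell minus \<open>k\<close>, so adjacent cells
    overlap in a band of width \<open>k\<close>.\<close>
  define P Q where "P = int M + 4 - int k" and "Q = int N + 4 - int k"
  have PQ: "int k < P" "int k < Q" "int M + 4 = P + int k" "int N + 4 = Q + int k" "P > 0" "Q > 0"
    using k by (auto simp: P_def Q_def)
  have cell_def: "cell a b = rect (M + 4) (N + 4) (a * P, b * Q)" for a b
    by (simp add: cell_def P_def Q_def)
  have mem_cell: "(x, y) \<in> cell a b \<longleftrightarrow>
      a * P \<le> x \<and> x < a * P + P + int k \<and> b * Q \<le> y \<and> y < b * Q + Q + int k" for x y a b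
    using PQ by (auto simp: cell_def)
  have step: "(c + 1) * R = c * R + R" for c R :: int by (simp add: distrib_right)
  \<comment> \<open>From the last column of a crossing, at offset \<open>k - 1\<close>, to the first
    column of the next, at offset \<open>P\<close>, there are exactly \<open>M + 5 - 2 * k\<close>
    steps, the exponent in the primitivity hypothesis.\<close>
  have gap: "int k - 1 + int (M + 5 - 2 * k) = P" "int k - 1 + int (N + 5 - 2 * k) = Q"
    and pos: "M + 5 - 2 * k > 0" "N + 5 - 2 * k > 0"
    using k by (auto simp: P_def Q_def)
  \<comment> \<open>The last conjunct forces the trivial strip when both ends agree: a walk might
    deviate in between, but pure cells must carry \<open>L a b\<close> on their bands.\<close>
  define is_H where "is_H a b Z \<longleftrightarrow> valid_on p B (UNIV \<times> {b * Q..<b * Q + int k}) Z \<and>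
    (\<forall>x y. x < a * P + int k \<longrightarrow> Z (x, y) = L a b (x, y)) \<and>
    (\<forall>x y. a * P + P \<le> x \<longrightarrow> Z (x, y) = L (a + 1) b (x, y)) \<and>
    (L (a + 1) b = L a b \<longrightarrow> Z = L a b)" for a b Z
  have "\<exists>Z. is_H a b Z" for a b
  proof (cases "L (a + 1) b = L a b")
    case True
    then show ?thesis
      using L[of a b] unfolding is_H_def by (intro exI[of _ "L a b"]) (auto intro: valid_on_mono)
  next
    case False
    obtain Z where "valid_on p B (UNIV \<times> {b * Q..<b * Q + int k}) Z"
      "\<forall>x y. x \<le> a * P + int k - 1 \<longrightarrow> Z (x, y) = L a b (x, y)"
      "\<forall>x y. a * P + int k - 1 + int (M + 5 - 2 * k) \<le> x \<longrightarrow> Z (x, y) = L (a + 1) b (x, y)"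
      using horizontal_strip[OF prim(1) pos(1) L L, of "b * Q" "a * P + int k - 1" a b "a + 1" b] by blast
    moreover have "a * P + int k - 1 + int (M + 5 - 2 * k) = a * P + P" using gap by linarith
    ultimately show ?thesis using False unfolding is_H_def by (intro exI[of _ Z]) simp
  qed
  then obtain H where "\<And>a b. is_H a b (H a b)" by metis
  then have H: "valid_on p B (UNIV \<times> {b * Q..<b * Q + int k}) (H a b)"
    "x < a * P + int k \<Longrightarrow> H a b (x, y) = L a b (x, y)"
    "a * P + P \<le> x \<Longrightarrow> H a b (x, y) = L (a + 1) b (x, y)"
    "L (a + 1) b = L a b \<Longrightarrow> H a b = L a b" for a b x y
    by (simp_all add: is_H_def)
  define is_V where "is_V a b Z \<longleftrightarrow> valid_on p B ({a * P..<a * P + int k} \<times> UNIV) Z \<and>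
    (\<forall>x y. y < b * Q + int k \<longrightarrow> Z (x, y) = L a b (x, y)) \<and>
    (\<forall>x y. b * Q + Q \<le> y \<longrightarrow> Z (x, y) = L a (b + 1) (x, y)) \<and>
    (L a (b + 1) = L a b \<longrightarrow> Z = L a b)" for a b Z
  have "\<exists>Z. is_V a b Z" for a b
  proof (cases "L a (b + 1) = L a b")
    case True
    then show ?thesis
      using L[of a b] unfolding is_V_def by (intro exI[of _ "L a b"]) (auto intro: valid_on_mono)
  next
    case False
    obtain Z where "valid_on p B ({a * P..<a * P + int k} \<times> UNIV) Z"
      "\<forall>x y. y \<le> b * Q + int k - 1 \<longrightarrow> Z (x, y) = L a b (x, y)"
      "\<forall>x y. b * Q + int k - 1 + int (N + 5 - 2 * k) \<le> y \<longrightarrow> Z (x, y) = L a (b + 1) (x, y)"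
      using vertical_strip[OF prim(2) pos(2) L L, of "a * P" "b * Q + int k - 1" a b a "b + 1"] by blast
    moreover have "b * Q + int k - 1 + int (N + 5 - 2 * k) = b * Q + Q" using gap by linarith
    ultimately show ?thesis using False unfolding is_V_def by (intro exI[of _ Z]) simp
  qed
  then obtain V where "\<And>a b. is_V a b (V a b)" by metis
  then have V: "valid_on p B ({a * P..<a * P + int k} \<times> UNIV) (V a b)"
    "y < b * Q + int k \<Longrightarrow> V a b (x, y) = L a b (x, y)"
    "b * Q + Q \<le> y \<Longrightarrow> V a b (x, y) = L a (b + 1) (x, y)"
    "L a (b + 1) = L a b \<Longrightarrow> V a b = L a b" for a b x y
    by (simp_all add: is_V_def)

  \<comment> \<open>On crossings \<open>H\<close>, \<open>V\<close> and \<open>L\<close> agree, so \<open>Z0\<close> extends every strip up to and including its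
    far crossing.\<close>
  define Z0 where "Z0 = (\<lambda>(x, y). let a = x div P; b = y div Q in
    if y mod Q < int k then H a b (x, y) else if x mod P < int k then V a b (x, y) else L a b (x, y))"
  have div: "x div R = c \<and> x mod R = x - c * R" if "c * R \<le> x" "x < c * R + R" for x c R :: int
    using that int_div_pos_eq[of x R c "x - c * R"] int_mod_pos_eq[of x R c "x - c * R"]
    by (simp add: mult.commute)
  have Z0: "Z0 (x, y) = (if y < b * Q + int k then H a b (x, y)
      else if x < a * P + int k then V a b (x, y) else L a b (x, y))"
    if "a * P \<le> x" "x < a * P + P" "b * Q \<le> y" "y < b * Q + Q" for a b x y
    using div[of a P x] div[of b Q y] that by (auto simp: Z0_def)
  have Z0_H: "Z0 (x, y) = H a b (x, y)"
    if "a * P \<le> x" "x < a * P + P + int k" "b * Q \<le> y" "y < b * Q + int k" for a b x y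
  proof (cases "x < a * P + P")
    case True
    with that PQ show ?thesis by (simp add: Z0[of a x b y])
  next
    case False
    with that PQ show ?thesis by (simp add: Z0[of "a + 1" x b y] step H(2,3))
  qed
  have Z0_V: "Z0 (x, y) = V a b (x, y)"
    if "a * P \<le> x" "x < a * P + int k" "b * Q \<le> y" "y < b * Q + Q + int k" for a b x y
  proof (cases "y < b * Q + Q")
    case True
    with that PQ show ?thesis by (simp add: Z0[of a x b y] H(2) V(2))
  next
    case False
    with that PQ show ?thesis by (simp add: Z0[of a x "b + 1" y] step H(2) V(3))
  qed
  \<comment> \<open>The four strips bounding a pure cell all equal \<open>L a b\<close>, and the
    interior carries \<open>L a b\<close> by construction.\<close>
  have Z0_pure: "Z0 q = L a b q" if "pure a b" "q \<in> cell a b" for a b q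
  proof -
    obtain x y where q: "q = (x, y)" by force
    have xy: "a * P \<le> x" "x < a * P + P + int k" "b * Q \<le> y" "y < b * Q + Q + int k"
      using that(2) by (auto simp: q mem_cell)
    have pure: "L (a + 1) b = L a b" "L a (b + 1) = L a b" "L (a + 1) (b + 1) = L a b"
      using that(1) by (auto simp: pure_def)
    have HV: "H a b = L a b" "H a (b + 1) = L a b" "V a b = L a b" "V (a + 1) b = L a b"
      using pure H(4)[of a b] H(4)[of a "b + 1"] V(4)[of a b] V(4)[of "a + 1" b] by auto
    consider "y < b * Q + int k" | "b * Q + Q \<le> y" | "x < a * P + int k" | "a * P + P \<le> x"
      | "b * Q + int k \<le> y" "y < b * Q + Q" "a * P + int k \<le> x" "x < a * P + P" by linarith
    then show ?thesis
    proof cases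
      case 1
      then show ?thesis using xy by (simp add: q Z0_H[of a x b y] HV)
    next
      case 2
      then show ?thesis using xy by (simp add: q Z0_H[of a x "b + 1" y] step HV)
    next
      case 3
      then show ?thesis using xy by (simp add: q Z0_V[of a x b y] HV)
    next
      case 4
      then show ?thesis using xy by (simp add: q Z0_V[of "a + 1" x b y] step HV)
    next
      case 5
      then show ?thesis using xy by (simp add: q Z0[of a x b y])
    qed
  qed

  define hb vb where "hb y \<longleftrightarrow> (\<exists>b. b * Q \<le> y \<and> y < b * Q + int k)"
    and "vb x \<longleftrightarrow> (\<exists>a. a * P \<le> x \<and> x < a * P + int k)" for x y :: int
  have bandI: "b * Q \<le> y \<Longrightarrow> y < b * Q + int k \<Longrightarrow> hb y"
    "b * Q + Q \<le> y \<Longrightarrow> y < b * Q + Q + int k \<Longrightarrow> hb y"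
    "a * P \<le> x \<Longrightarrow> x < a * P + int k \<Longrightarrow> vb x"
    "a * P + P \<le> x \<Longrightarrow> x < a * P + P + int k \<Longrightarrow> vb x" for a b x y
    unfolding hb_def vb_def by (metis step)+
  \<comment> \<open>The region under control: all bands, and the cells of \<open>T\<close>.\<close>
  define G where "G T = {(x, y). hb y \<or> vb x} \<union> (\<Union>(a, b) \<in> T. cell a b)" for T
  have G_pure: "valid_on p B (G {(a, b). pure a b}) Z0"
    unfolding valid_on_def
  proof (intro conjI ballI allI impI)
    fix q assume "q \<in> G {(a, b). pure a b}"
    moreover obtain x y where q: "q = (x, y)" by force
    ultimately consider b where "b * Q \<le> y" "y < b * Q + int k"
      | a where "a * P \<le> x" "x < a * P + int k" | a b where "pure a b" "(x, y) \<in> cell a b"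
      by (auto simp: G_def hb_def vb_def)
    then show "Z0 q < p"
    proof cases
      case 1
      obtain a where "a * P \<le> x" "x < a * P + P" using ex_multiple_interval[OF PQ(5)] by blast
      with 1 H(1)[of b a] show ?thesis by (auto simp: q Z0_H[of a x b y] valid_on_def)
    next
      case 2
      obtain b where "b * Q \<le> y" "y < b * Q + Q" using ex_multiple_interval[OF PQ(6)] by blast
      with 2 V(1)[of a b] show ?thesis by (auto simp: q Z0_V[of a x b y] valid_on_def)
    next
      case 3
      with L[of a b] show ?thesis by (auto simp: q Z0_pure[of a b] valid_on_def)
    qed
  next
    fix i j assume w: "rect 2 2 (i, j) \<subseteq> G {(a, b). pure a b}"
    show "translate_restrict Z0 (i, j) \<in> B"
    proof (cases "\<exists>a b. pure a b \<and> rect 2 2 (i, j) \<subseteq> cell a b")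
      case True
      then obtain a b where ab: "pure a b" "rect 2 2 (i, j) \<subseteq> cell a b" by blast
      then have "translate_restrict Z0 (i, j) = translate_restrict (L a b) (i, j)"
        by (intro translate_restrict_cong Z0_pure) auto
      with L[of a b] show ?thesis by (simp add: valid_on_def)
    next
      case False
      \<comment> \<open>A point off the bands lies in the interior of its cell, so a window through
        it cannot leave that cell. As no pure cell contains the window, all its points lie on
        bands.\<close>
      have band: "hb y \<or> vb x" if "x \<in> {i, i + 1}" "y \<in> {j, j + 1}" for x y
      proof (rule ccontr)
        assume no: "\<not> (hb y \<or> vb x)"
        have "(x, y) \<in> rect 2 2 (i, j)" using that by auto
        with w have "(x, y) \<in> G {(a, b). pure a b}" by blast
        with no obtain a b where ab: "pure a b" "(x, y) \<in> cell a b" by (auto simp: G_def)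
        have "a * P + int k \<le> x" "b * Q + int k \<le> y" "x < a * P + P" "y < b * Q + Q"
          using no ab(2) bandI(1,2)[of b y] bandI(3,4)[of a x] unfolding mem_cell by linarith+
        then have "rect 2 2 (i, j) \<subseteq> cell a b"
          using that k(1) by (auto simp: rect_2_2_subset_iff mem_cell)
        with ab False show False by blast
      qed
      \<comment> \<open>If one of the two rows is in no horizontal band, both columns must lie in
        vertical bands.\<close>
      then consider "hb j" "hb (j + 1)" | "vb i" "vb (i + 1)" by blast
      then show ?thesis
      proof cases
        case 1
        then obtain b b' where "b * Q \<le> j" "j < b * Q + int k" "b' * Q \<le> j + 1" "j + 1 < b' * Q + int k"
          by (auto simp: hb_def)
        with band_adjacent[of "int k" Q b j b'] PQ have b: "b * Q \<le> j" "j + 1 < b * Q + int k" by auto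
        obtain a where a: "a * P \<le> i" "i < a * P + P" using ex_multiple_interval[OF PQ(5)] by blast
        have "translate_restrict Z0 (i, j) = translate_restrict (H a b) (i, j)"
          using a b k(1) by (intro translate_restrict_cong) (auto simp: rect_def intro!: Z0_H)
        with H(1)[of b a] b show ?thesis by (auto simp: valid_on_def rect_2_2_subset_iff)
      next
        case 2
        then obtain a a' where "a * P \<le> i" "i < a * P + int k" "a' * P \<le> i + 1" "i + 1 < a' * P + int k"
          by (auto simp: vb_def)
        with band_adjacent[of "int k" P a i a'] PQ have a: "a * P \<le> i" "i + 1 < a * P + int k" by auto
        obtain b where b: "b * Q \<le> j" "j < b * Q + Q" using ex_multiple_interval[OF PQ(6)] by blast
        have "translate_restrict Z0 (i, j) = translate_restrict (V a b) (i, j)"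
          using a b k(1) by (intro translate_restrict_cong) (auto simp: rect_def intro!: Z0_V)
        with V(1)[of a b] a show ?thesis by (auto simp: valid_on_def rect_2_2_subset_iff)
      qed
    qed
  qed

  \<comment> \<open>Impure cells are filled one class of index pairs modulo 2 at a time. Agreement
    with \<open>Z0\<close> survives because only points of impure cells ever change.\<close>
  have fill: "\<exists>Z. valid_on p B (G ({(a, b). pure a b} \<union> {(a, b). (a mod 2, b mod 2) \<in> E})) Z \<and>
      (\<forall>q. (\<forall>a b. q \<in> cell a b \<longrightarrow> pure a b) \<longrightarrow> Z q = Z0 q)" if "finite E" for E
    using that
  proof (induction E rule: finite_induct)
    case empty
    then show ?case using G_pure by auto
  next
    case (insert e E)
    let ?T = "{(a, b). pure a b} \<union> {(a, b). (a mod 2, b mod 2) \<in> E}"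
    from insert.IH obtain Z where Z: "valid_on p B (G ?T) Z"
      "\<And>q. (\<forall>a b. q \<in> cell a b \<longrightarrow> pure a b) \<Longrightarrow> Z q = Z0 q" by blast
    define C where "C = {(a * P, b * Q) | a b. \<not> pure a b \<and> (a mod 2, b mod 2) = e}"
    have cells: "(\<Union>c \<in> C. rect (M + 4) (N + 4) c) =
        (\<Union>(a, b) \<in> {(a, b). \<not> pure a b \<and> (a mod 2, b mod 2) = e}. cell a b)"
      by (auto simp: C_def cell_def)
    have far: "c * R + 2 * R \<le> d * R" if "c < d" "c mod 2 = d mod 2" "R > 0" for c d R :: int
    proof -
      have "c + 2 \<le> d" using that(1,2) by presburger
      then have "(c + 2) * R \<le> d * R" using that(3) by (intro mult_right_mono) auto
      then show ?thesis by (simp add: distrib_right)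
    qed
    \<comment> \<open>Distinct corners of one class are at least two periods apart in some
      direction, which exceeds the side \<open>P + k\<close> or \<open>Q + k\<close> of a
      cell.\<close>
    have disj: "rect (M + 4) (N + 4) c \<inter> rect (M + 4) (N + 4) d = {}"
      if cd: "c \<in> C" "d \<in> C" and ne: "c \<noteq> d" for c d
    proof -
      obtain a b where c: "c = (a * P, b * Q)" "(a mod 2, b mod 2) = e" using cd(1) unfolding C_def by blast
      obtain a' b' where d: "d = (a' * P, b' * Q)" "(a' mod 2, b' mod 2) = e" using cd(2) unfolding C_def by blast
      have ab: "c = (a * P, b * Q)" "d = (a' * P, b' * Q)" "a mod 2 = a' mod 2" "b mod 2 = b' mod 2"
        using c d by auto
      have "a \<noteq> a' \<or> b \<noteq> b'" using ne ab(1,2) by blast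
      then have "a < a' \<or> a' < a \<or> b < b' \<or> b' < b" by (auto simp: neq_iff)
      then have "a * P + 2 * P \<le> a' * P \<or> a' * P + 2 * P \<le> a * P \<or>
          b * Q + 2 * Q \<le> b' * Q \<or> b' * Q + 2 * Q \<le> b * Q"
        using far[OF _ ab(3) PQ(5)] far[OF _ ab(3)[symmetric] PQ(5)]
          far[OF _ ab(4) PQ(6)] far[OF _ ab(4)[symmetric] PQ(6)] by blast
      then show ?thesis using PQ(1-4) by (auto simp: ab(1,2))
    qed
    \<comment> \<open>The thick annulus consists of points of bands, on which \<open>Z\<close> is
      valid whatever was filled before.\<close>
    have ann: "annulus (M + 4 - 2 * k) (N + 4 - 2 * k) k (x + int k, y + int k) \<subseteq> G ?T"
      if xy: "(x, y) \<in> C" for x y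
    proof -
      obtain a b where ab: "x = a * P" "y = b * Q" using xy unfolding C_def by blast
      define m n where "m = M + 4 - 2 * k" and "n = N + 4 - 2 * k"
      then have mn: "int m = P - int k" "int n = Q - int k" using k by (auto simp: P_def Q_def)
      have "hb v \<or> vb u" if "(u, v) \<in> annulus m n k (x + int k, y + int k)" for u v
      proof -
        have "(u, v) \<in> cell a b \<and> (u < a * P + int k \<or> v < b * Q + int k \<or> a * P + P \<le> u \<or> b * Q + Q \<le> v)"
          using that by (auto simp: annulus_def mem_cell ab mn)
        then show ?thesis using bandI(1,2)[of b v] bandI(3,4)[of a u] unfolding mem_cell by linarith
      qed
      then show ?thesis by (auto simp: G_def m_def n_def)
    qed
    from HFC_fill_family[OF hfc k disj Z(1) ann] obtain Z' where
      Z': "valid_on p B (G ?T \<union> (\<Union>c \<in> C. rect (M + 4) (N + 4) c)) Z'"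
        "\<And>q. q \<notin> (\<Union>c \<in> C. rect (M + 4) (N + 4) c) \<Longrightarrow> Z' q = Z q" by blast
    have "valid_on p B (G ({(a, b). pure a b} \<union> {(a, b). (a mod 2, b mod 2) \<in> insert e E})) Z'"
      by (rule valid_on_mono[OF Z'(1)]) (auto simp: G_def cells; blast)
    moreover have "Z' q = Z0 q" if "\<forall>a b. q \<in> cell a b \<longrightarrow> pure a b" for q
    proof -
      have "q \<notin> (\<Union>c \<in> C. rect (M + 4) (N + 4) c)" unfolding cells using that by blast
      with Z'(2) Z(2)[OF that] show ?thesis by simp
    qed
    ultimately show ?case by blast
  qed
  \<comment> \<open>With all four classes filled, \<open>T\<close> contains every cell and
    \<open>G T\<close> is the plane.\<close>
  define T where "T = {(a, b). pure a b} \<union> {(a, b). (a mod 2, b mod 2) \<in> {0, 1 :: int} \<times> {0, 1 :: int}}"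
  obtain Z where Z: "valid_on p B (G T) Z"
    "\<And>q. (\<forall>a b. q \<in> cell a b \<longrightarrow> pure a b) \<Longrightarrow> Z q = Z0 q"
    using fill[of "{0, 1} \<times> {0, 1}"] unfolding T_def by auto
  have T: "(a, b) \<in> T" for a b by (auto simp: T_def)
  have "q \<in> G T" for q
  proof -
    obtain x y where q: "q = (x, y)" by force
    obtain a b where "a * P \<le> x" "x < a * P + P" "b * Q \<le> y" "y < b * Q + Q"
      using ex_multiple_interval[OF PQ(5)] ex_multiple_interval[OF PQ(6)] by metis
    then have "q \<in> cell a b" by (simp add: q mem_cell)
    with T[of a b] show ?thesis unfolding G_def by blast
  qed
  then have "G T = UNIV" by blast
  with Z(1) have "valid_on p B UNIV Z" by simp
  moreover have "Z q = L a b q" if "\<forall>a b. q \<in> cell a b \<longrightarrow> pure a b" "q \<in> cell a b" for q a b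
    using Z(2)[OF that(1)] Z0_pure[of a b q] that by simp
  ultimately show ?thesis by blast
qed

section \<open>Separating the two sets\<close>

text \<open>The taxicab distance dominates the Euclidean one and is an integer, so distances can be
  bounded coordinate by coordinate.\<close>

lemma lattice_dist_le_taxicab:
  assumes "(x, y) \<in> R" "(x', y') \<in> S"
  shows "lattice_dist R S \<le> ereal (of_int (\<bar>x - x'\<bar> + \<bar>y - y'\<bar>))"
proof -
  have "lattice_dist R S \<le> ereal (dist (real_of_int x, real_of_int y) (real_of_int x', real_of_int y'))"
    unfolding lattice_dist_def
    by (rule INF_lower2[OF assms(1)], simp, rule INF_lower2[OF assms(2)]) simp
  also have "dist (real_of_int x, real_of_int y) (real_of_int x', real_of_int y') \<le>
      of_int (\<bar>x - x'\<bar> + \<bar>y - y'\<bar>)"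
    using sqrt_sum_squares_le_sum_abs[of "real_of_int x - x'" "real_of_int y - y'"]
    by (simp add: dist_Pair_Pair dist_real_def)
  finally show ?thesis by simp
qed

theorem theorem1p2:
  fixes p :: nat and B :: "pattern set"
  assumes "p \<ge> 2"
    and "B \<subseteq> patterns p (rect 2 2 (0, 0))"
    and "\<exists>k \<ge> 2.
      nonzero_rows (H_mat p B k) = nonzero_cols (H_mat p B k) \<and>
      nonzero_rows (V_mat p B k) = nonzero_cols (V_mat p B k) \<and>
      (\<exists>M N. M \<ge> 2 * k - 3 \<and> N \<ge> 2 * k - 3 \<and> HFC p B k M N \<and>
        weakly_primitive (M + 5 - 2 * k) (H_mat p B k) \<and>
        weakly_primitive (N + 5 - 2 * k) (V_mat p B k))"
  shows "strong_specification (shift_space p B)"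
proof -
  obtain k M N where k: "k \<ge> 2" "M \<ge> 2 * k - 3" "N \<ge> 2 * k - 3" and hfc: "HFC p B k M N"
    and prim: "weakly_primitive (M + 5 - 2 * k) (H_mat p B k)"
      "weakly_primitive (N + 5 - 2 * k) (V_mat p B k)"
    using assms(3) by blast
  define P Q where "P = int M + 4 - int k" and "Q = int N + 4 - int k"
  have PQ: "P > 0" "Q > 0" "P \<le> int M + 4" "Q \<le> int N + 4" using k by (auto simp: P_def Q_def)
  define cell where "cell a b = rect (M + 4) (N + 4) (a * P, b * Q)" for a b
  \<comment> \<open>Points of neighbouring cells differ by less than \<open>2 * (M + 4)\<close>
    horizontally and \<open>2 * (N + 4)\<close> vertically: once for the shift of the corner, once
    for the position in the cell.\<close>
  define D where "D = 2 * (int M + 4) + 2 * (int N + 4)"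
  have step: "(c + 1) * R = c * R + R" "(c - 1) * R = c * R - R" for c R :: int
    by (simp_all add: algebra_simps)
  show ?thesis unfolding strong_specification_def
  proof (intro exI[of _ "real_of_int D"] conjI allI impI ballI)
    show "real_of_int D \<ge> 1" by (simp add: D_def)
  next
    fix R1 R2 U1 U2
    assume dist: "ereal (real_of_int D) \<le> lattice_dist R1 R2"
      and U: "U1 \<in> proj R1 (shift_space p B)" "U2 \<in> proj R2 (shift_space p B)"
    obtain W1 W2 where W: "valid_on p B UNIV W1" "valid_on p B UNIV W2"
      "U1 = restrict W1 R1" "U2 = restrict W2 R2"
      using U by (auto simp: proj_def admissible_iff_valid_on)
    \<comment> \<open>Crossing \<open>(a, b)\<close> is a corner of the four cells with indices
      \<open>a - 1\<close> or \<open>a\<close> and \<open>b - 1\<close> or \<open>b\<close>. So all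
      corners of a cell meeting \<open>R1\<close> carry \<open>W1\<close>.\<close>
    define near where
      "near a b \<longleftrightarrow> (\<exists>a' \<in> {a - 1, a}. \<exists>b' \<in> {b - 1, b}. cell a' b' \<inter> R1 \<noteq> {})" for a b
    define L where "L a b = (if near a b then W1 else W2)" for a b
    let ?pure = "\<lambda>a b. L (a + 1) b = L a b \<and> L a (b + 1) = L a b \<and> L (a + 1) (b + 1) = L a b"
    have R1: "L a b = W1 \<and> ?pure a b" if "cell a b \<inter> R1 \<noteq> {}" for a b
      using that by (auto simp: L_def near_def)
    \<comment> \<open>The corners of a cell belong only to cells of the 3 by 3 block around it. If
      the middle cell meets \<open>R2\<close>, no cell of the block meets \<open>R1\<close>, so its
      corners all carry \<open>W2\<close>.\<close>
    have far: "cell a' b' \<inter> R1 = {}"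
      if R2: "cell a b \<inter> R2 \<noteq> {}" and ab: "a' \<in> {a - 1, a, a + 1}" "b' \<in> {b - 1, b, b + 1}" for a b a' b'
    proof (rule ccontr)
      assume "cell a' b' \<inter> R1 \<noteq> {}"
      then obtain x y where 1: "(x, y) \<in> cell a' b'" "(x, y) \<in> R1" by auto
      obtain x' y' where 2: "(x', y') \<in> cell a b" "(x', y') \<in> R2" using R2 by auto
      have "\<bar>a' * P - a * P\<bar> \<le> int M + 4" "\<bar>b' * Q - b * Q\<bar> \<le> int N + 4"
        using ab PQ by (auto simp: step)
      then have "\<bar>x - x'\<bar> + \<bar>y - y'\<bar> < D"
        using 1(1) 2(1) by (auto simp: cell_def D_def)
      moreover have "ereal (real_of_int D) \<le> ereal (of_int (\<bar>x - x'\<bar> + \<bar>y - y'\<bar>))"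
        using dist lattice_dist_le_taxicab[OF 1(2) 2(2)] by (rule order_trans)
      ultimately show False by (metis ereal_less_eq(3) of_int_le_iff not_le)
    qed
    have R2: "L a b = W2 \<and> ?pure a b" if "cell a b \<inter> R2 \<noteq> {}" for a b
    proof -
      have "\<not> near a' b'" if "a' \<in> {a, a + 1}" "b' \<in> {b, b + 1}" for a' b'
      proof
        assume "near a' b'"
        then obtain c d where "cell c d \<inter> R1 \<noteq> {}" "c \<in> {a' - 1, a'}" "d \<in> {b' - 1, b'}"
          unfolding near_def by blast
        moreover from this that have "c \<in> {a - 1, a, a + 1}" "d \<in> {b - 1, b, b + 1}" by auto
        ultimately show False using far[OF \<open>cell a b \<inter> R2 \<noteq> {}\<close>] by blast
      qed
      then show ?thesis by (simp add: L_def)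
    qed
    have "valid_on p B UNIV (L a b)" for a b using W by (simp add: L_def)
    then obtain Z where Z: "valid_on p B UNIV Z"
      "\<forall>q. (\<forall>a b. q \<in> cell a b \<longrightarrow> ?pure a b) \<longrightarrow> (\<forall>a b. q \<in> cell a b \<longrightarrow> Z q = L a b q)"
      using patching[where L = L, OF k hfc prim] unfolding cell_def P_def Q_def by blast
    have cover: "\<exists>a b. q \<in> cell a b" for q
    proof -
      obtain x y where q: "q = (x, y)" by force
      obtain a b where "a * P \<le> x" "x < a * P + P" "b * Q \<le> y" "y < b * Q + Q"
        using ex_multiple_interval[OF PQ(1)] ex_multiple_interval[OF PQ(2)] by metis
      then have "q \<in> cell a b" using PQ by (simp add: q cell_def)
      then show ?thesis by blast
    qed
    \<comment> \<open>Every cell containing a point of \<open>R1\<close> meets \<open>R1\<close> and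
      is therefore pure, so \<open>Z\<close> is determined there.\<close>
    have "Z q = W1 q" if "q \<in> R1" for q
    proof -
      obtain a b where ab: "q \<in> cell a b" using cover by blast
      have W1: "L a b = W1 \<and> ?pure a b" if "q \<in> cell a b" for a b
        using that \<open>q \<in> R1\<close> by (intro R1) auto
      then have "Z q = L a b q" using Z(2) ab by blast
      with W1[OF ab] show ?thesis by simp
    qed
    moreover have "Z q = W2 q" if "q \<in> R2" for q
    proof -
      obtain a b where ab: "q \<in> cell a b" using cover by blast
      have W2: "L a b = W2 \<and> ?pure a b" if "q \<in> cell a b" for a b
        using that \<open>q \<in> R2\<close> by (intro R2) auto
      then have "Z q = L a b q" using Z(2) ab by blast
      with W2[OF ab] show ?thesis by simp
    qed
    ultimately have "restrict Z R1 = U1" "restrict Z R2 = U2"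
      by (auto simp: W(3,4) intro: restrict_ext)
    moreover have "Z \<in> shift_space p B" using Z(1) by (simp add: admissible_iff_valid_on)
    ultimately show "\<exists>W \<in> shift_space p B. restrict W R1 = U1 \<and> restrict W R2 = U2" by blast
  qed
qed

end
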